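(* Let $k\ge 2$, let $U$ be a finite nonempty set, and let $f:\{0,\ldots,k\}^U\to\mathbb{R}_{+}$ be submodular in every orthant and $k$-wise monotone. Let $\mathbf{o}$ be an orthant of $U$ that maximizes $f$, and let $\mathbf{s}$ be the (random) orthant produced by the randomized greedy algorithm on $f$ (for an arbitrary processing order of $U$). Then \[\left(1+\sqrt{\tfrac{k}{2}}\right)\mathbb{E}[f(\mathbf{s})]\ \ge\ f(\mathbf{o}).\]
   Context: $\mathbb{R}_{+}$ denotes the non-negative reals. For $s,t\in\{0,\ldots,k\}$ define $\mathrm{min}_0(s,t)=0$ if $s\neq 0$, $t\neq 0$ and $s\neq t$, and $\mathrm{min}_0(s,t)=\min(s,t)$ otherwise; define $\mathrm{max}_0(s,t)=0$ if $s\neq 0$, $t\neq 0$ and $s\neq t$, and $\mathrm{max}_0(s,t)=\max(s,t)$ otherwise. Both are applied coordinate-wise to vectors. Vectors in $\{0,\ldots,k\}^U$ are called partial solutions; an orthant is a vector $\mathbf{x}\in\{1,\ldots,k\}^U$. A partial solution $\mathbf{s}$ is in orthant $\mathbf{x}$ if $s_e\in\{0,x_e\}$ for all $e\in U$. $f$ is submodular in every orthant if for any two partial solutions $\mathbf{a},\mathbf{b}$ in a common orthant, $f(\mathbf{a})+f(\mathbf{b})\ge f(\mathrm{min}_0(\mathbf{a},\mathbf{b}))+f(\mathrm{max}_0(\mathbf{a},\mathbf{b}))$. For $e\in U$, $i\in\{1,\ldots,k\}$ and $\mathbf{s}$ with $s_e=0$, let $f_{i,e}(\mathbf{s})=f(\mathbf{s}+i\cdot\mathbf{1}_e)-f(\mathbf{s})$,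 where $\mathbf{1}_e$ is the unit vector of coordinate $e$. $f$ is $k$-wise monotone if $\sum_{i=1}^k f_{i,e}(\mathbf{s})\ge 0$ for every $e\in U$ and every $\mathbf{s}$ with $s_e=0$. Randomized greedy algorithm: start with $\mathbf{s}=\mathbf{0}$. Process the elements of $U$ one at a time in an arbitrary fixed order; when processing $e$, compute $y_i=\max(0,f_{i,e}(\mathbf{s}))$ for $i=1,\ldots,k$ with respect to the current $\mathbf{s}$ and let $\beta=\sum_{i=1}^k y_i$. If $\beta\neq 0$, choose $q\in\{1,\ldots,k\}$ at random with $\Pr[q=\ell]=y_\ell/\beta$ (with fresh randomness, given the past) and permanently set $s_e\gets q$; if $\beta=0$, set $s_e\gets 1$. After all elements have been processed, return $\mathbf{s}$. *)

theory Defs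
  imports "HOL-Probability.Probability"
begin

text \<open>
  Vectors in \<open>{0..k}^U\<close> are the extensional functions in \<open>U \<rightarrow>\<^sub>E {0..k}\<close>; the label \<open>0\<close>
  means unassigned.
\<close>

definition partial_solutions :: "'a set \<Rightarrow> nat \<Rightarrow> ('a \<Rightarrow> nat) set" where
  "partial_solutions U k = U \<rightarrow>\<^sub>E {0..k}"

definition orthants :: "'a set \<Rightarrow> nat \<Rightarrow> ('a \<Rightarrow> nat) set" where
  "orthants U k = U \<rightarrow>\<^sub>E {1..k}"

definition in_orthant :: "'a set \<Rightarrow> ('a \<Rightarrow> nat) \<Rightarrow> ('a \<Rightarrow> nat) \<Rightarrow> bool" where
  "in_orthant U s x \<longleftrightarrow> (\<forall>e\<in>U. s e \<in> {0, x e})"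

definition min0 :: "nat \<Rightarrow> nat \<Rightarrow> nat" where
  "min0 s t = (if s \<noteq> 0 \<and> t \<noteq> 0 \<and> s \<noteq> t then 0 else min s t)"

definition max0 :: "nat \<Rightarrow> nat \<Rightarrow> nat" where
  "max0 s t = (if s \<noteq> 0 \<and> t \<noteq> 0 \<and> s \<noteq> t then 0 else max s t)"

text \<open>
  The coordinate-wise \<open>min0\<close> and \<open>max0\<close> need no restriction to \<open>U\<close>: both operations are
  idempotent, so outside \<open>U\<close> they return \<open>undefined\<close> on extensional arguments.
\<close>

lemma min0_partial_solutions:
  assumes "a \<in> partial_solutions U k" "b \<in> partial_solutions U k"
  shows "(\<lambda>e. min0 (a e) (b e)) \<in> partial_solutions U k"
  using assms unfolding partial_solutions_def min0_def
  by (auto simp: PiE_iff extensional_def min_def)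

lemma max0_partial_solutions:
  assumes "a \<in> partial_solutions U k" "b \<in> partial_solutions U k"
  shows "(\<lambda>e. max0 (a e) (b e)) \<in> partial_solutions U k"
  using assms unfolding partial_solutions_def max0_def
  by (auto simp: PiE_iff extensional_def max_def)

definition submodular_in_every_orthant ::
    "'a set \<Rightarrow> nat \<Rightarrow> (('a \<Rightarrow> nat) \<Rightarrow> real) \<Rightarrow> bool" where
  "submodular_in_every_orthant U k f \<longleftrightarrow>
    (\<forall>x\<in>orthants U k. \<forall>a\<in>partial_solutions U k. \<forall>b\<in>partial_solutions U k.
      in_orthant U a x \<longrightarrow> in_orthant U b x \<longrightarrow>
      f a + f b \<ge> f (\<lambda>e. min0 (a e) (b e)) + f (\<lambda>e. max0 (a e) (b e)))"

text \<open>
  \<open>f\<^sub>i\<^sub>,\<^sub>e(s) = f(s + i \<cdot> 1\<^sub>e) - f(s)\<close>. It is only used when \<open>s e = 0\<close>, where the update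
  \<open>s(e := i)\<close> is \<open>s + i \<cdot> 1\<^sub>e\<close>.
\<close>

definition marginal :: "(('a \<Rightarrow> nat) \<Rightarrow> real) \<Rightarrow> nat \<Rightarrow> 'a \<Rightarrow> ('a \<Rightarrow> nat) \<Rightarrow> real" where
  "marginal f i e s = f (s(e := i)) - f s"

definition k_wise_monotone :: "'a set \<Rightarrow> nat \<Rightarrow> (('a \<Rightarrow> nat) \<Rightarrow> real) \<Rightarrow> bool" where
  "k_wise_monotone U k f \<longleftrightarrow>
    (\<forall>e\<in>U. \<forall>s\<in>partial_solutions U k. s e = 0 \<longrightarrow> (\<Sum>i=1..k. marginal f i e s) \<ge> 0)"

definition greedy_weight ::
    "(('a \<Rightarrow> nat) \<Rightarrow> real) \<Rightarrow> 'a \<Rightarrow> ('a \<Rightarrow> nat) \<Rightarrow> nat \<Rightarrow> real" where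
  "greedy_weight f e s i = max 0 (marginal f i e s)"

definition greedy_total ::
    "nat \<Rightarrow> (('a \<Rightarrow> nat) \<Rightarrow> real) \<Rightarrow> 'a \<Rightarrow> ('a \<Rightarrow> nat) \<Rightarrow> real" where
  "greedy_total k f e s = (\<Sum>i=1..k. greedy_weight f e s i)"

definition greedy_choice ::
    "nat \<Rightarrow> (('a \<Rightarrow> nat) \<Rightarrow> real) \<Rightarrow> 'a \<Rightarrow> ('a \<Rightarrow> nat) \<Rightarrow> nat pmf" where
  "greedy_choice k f e s =
    (if greedy_total k f e s \<noteq> 0
     then embed_pmf (\<lambda>l. if l \<in> {1..k} then greedy_weight f e s l / greedy_total k f e s else 0)
     else return_pmf 1)"

text \<open>The argument of \<open>embed_pmf\<close> above is a probability mass function:\<close>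

lemma pmf_greedy_choice:
  assumes "greedy_total k f e s \<noteq> 0"
  shows "pmf (greedy_choice k f e s) l =
    (if l \<in> {1..k} then greedy_weight f e s l / greedy_total k f e s else 0)"
proof -
  let ?p = "\<lambda>l. if l \<in> {1..k} then greedy_weight f e s l / greedy_total k f e s else 0"
  have nonneg: "0 \<le> ?p l" for l
    by (simp add: greedy_weight_def greedy_total_def sum_nonneg)
  have "(\<integral>\<^sup>+l. ennreal (?p l) \<partial>count_space UNIV)
      = (\<integral>\<^sup>+l. ennreal (?p l) * indicator {1..k} l \<partial>count_space UNIV)"
    by (intro nn_integral_cong) (auto simp: indicator_def)
  also have "\<dots> = (\<Sum>l\<in>{1..k}. ennreal (?p l))"
    by (subst nn_integral_count_space_indicator[symmetric])
       (auto simp: nn_integral_count_space_finite)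
  also have "\<dots> = ennreal (\<Sum>l\<in>{1..k}. ?p l)"
    by (rule sum_ennreal) (rule nonneg)
  also have "(\<Sum>l\<in>{1..k}. ?p l) = (\<Sum>l\<in>{1..k}. greedy_weight f e s l / greedy_total k f e s)"
    by (intro sum.cong) auto
  also have "\<dots> = 1"
    using assms by (simp add: sum_divide_distrib[symmetric] greedy_total_def)
  finally have total: "(\<integral>\<^sup>+l. ennreal (?p l) \<partial>count_space UNIV) = 1"
    by simp
  have "pmf (embed_pmf ?p) l = ?p l"
    using nonneg total by (rule pmf_embed_pmf)
  thus ?thesis
    using assms by (simp only: greedy_choice_def if_True not_False_eq_True)
qed

primrec greedy_from ::
    "nat \<Rightarrow> (('a \<Rightarrow> nat) \<Rightarrow> real) \<Rightarrow> 'a list \<Rightarrow> ('a \<Rightarrow> nat) \<Rightarrow> ('a \<Rightarrow> nat) pmf" where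
  "greedy_from k f [] s = return_pmf s"
| "greedy_from k f (e # es) s =
    bind_pmf (greedy_choice k f e s) (\<lambda>q. greedy_from k f es (s(e := q)))"

text \<open>The list \<open>es\<close> is the processing order, an enumeration of \<open>U\<close> without repetition.\<close>

definition randomized_greedy ::
    "'a set \<Rightarrow> nat \<Rightarrow> (('a \<Rightarrow> nat) \<Rightarrow> real) \<Rightarrow> 'a list \<Rightarrow> ('a \<Rightarrow> nat) pmf" where
  "randomized_greedy U k f es = greedy_from k f es (\<lambda>e\<in>U. 0)"

end

theory Submission
  imports Defs
begin

text \<open>
  Along the run, compare the current partial solution \<open>s\<close> with the hybrid \<open>h\<close> that agrees with
  \<open>s\<close> on the processed elements and with the optimum elsewhere. Processing \<open>e\<close> with choice \<open>q\<close>
  changes \<open>f h\<close> by \<open>a q - a (opt e)\<close>, where \<open>a i\<close> is the marginal at \<open>h(e := 0)\<close>, and \<open>f s\<close> by the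
  marginal \<open>y q\<close> at \<open>s\<close>. Orthant submodularity gives \<open>a i \<le> y i\<close> and \<open>k\<close>-wise monotonicity gives
  \<open>(\<Sum>i. a i) \<ge> 0\<close>; under these constraints the expected loss of \<open>h\<close> is at most \<open>sqrt (k / 2)\<close>
  times the expected gain of \<open>s\<close>. Initially \<open>h\<close> is the optimum, and finally \<open>h = s\<close>.
\<close>

section \<open>The real inequality behind the constant \<open>sqrt (k / 2)\<close>\<close>

text \<open>AM-GM on each \<open>(u + v) * y i\<close>, weighted to leave exactly
  \<open>(1 + \<alpha>) * (y i)\<^sup>2\<close>. As
  \<open>card R = 2 * (\<alpha> - 1) * (\<alpha> + 1)\<close>, the remainders add up to
  \<open>(\<alpha> - 1) / 2 * (u + v)\<^sup>2\<close>, and what is left is a nonnegative multiple of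
  \<open>(u - v)\<^sup>2\<close>.\<close>

lemma loss_quadratic_bound:
  fixes y :: "'b \<Rightarrow> real" and u v \<alpha> :: real
  assumes "finite R" and \<alpha>: "\<alpha> \<ge> 1" "\<alpha>\<^sup>2 = (real (card R) + 2) / 2"
  shows "2 * u * v + (u + v) * (\<Sum>i\<in>R. y i) \<le> \<alpha> * (u\<^sup>2 + v\<^sup>2) + (1 + \<alpha>) * (\<Sum>i\<in>R. (y i)\<^sup>2)"
proof -
  have am_gm: "(u + v) * x \<le> (u + v)\<^sup>2 / (4 * (1 + \<alpha>)) + (1 + \<alpha>) * x\<^sup>2" for x
  proof -
    have "0 \<le> (u + v - 2 * (1 + \<alpha>) * x)\<^sup>2 / (4 * (1 + \<alpha>))"
      using \<alpha> by simp
    also have "\<dots> = (u + v)\<^sup>2 / (4 * (1 + \<alpha>)) + (1 + \<alpha>) * x\<^sup>2 - (u + v) * x"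
      using \<alpha> by (simp add: field_simps power2_eq_square)
    finally show ?thesis by simp
  qed
  have "(u + v) * (\<Sum>i\<in>R. y i) \<le> (\<Sum>i\<in>R. (u + v)\<^sup>2 / (4 * (1 + \<alpha>)) + (1 + \<alpha>) * (y i)\<^sup>2)"
    unfolding sum_distrib_left by (rule sum_mono) (rule am_gm)
  also have "\<dots> = real (card R) / (4 * (1 + \<alpha>)) * (u + v)\<^sup>2 + (1 + \<alpha>) * (\<Sum>i\<in>R. (y i)\<^sup>2)"
    by (simp add: sum.distrib sum_distrib_left)
  also have "real (card R) / (4 * (1 + \<alpha>)) = (\<alpha> - 1) / 2"
    using \<alpha> by (simp add: field_simps power2_eq_square)
  finally have "(u + v) * (\<Sum>i\<in>R. y i) \<le> (\<alpha> - 1) / 2 * (u + v)\<^sup>2 + (1 + \<alpha>) * (\<Sum>i\<in>R. (y i)\<^sup>2)" .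
  moreover have "2 * u * v + (\<alpha> - 1) / 2 * (u + v)\<^sup>2 \<le> \<alpha> * (u\<^sup>2 + v\<^sup>2)"
  proof -
    have "\<alpha> * (u\<^sup>2 + v\<^sup>2) - (2 * u * v + (\<alpha> - 1) / 2 * (u + v)\<^sup>2) = (1 + \<alpha>) / 2 * (u - v)\<^sup>2"
      by (simp add: field_simps power2_eq_square)
    moreover have "(1 + \<alpha>) / 2 * (u - v)\<^sup>2 \<ge> 0" using \<alpha> by simp
    ultimately show ?thesis by linarith
  qed
  ultimately show ?thesis by linarith
qed

text \<open>Eliminates \<open>a\<close>: \<open>a p\<close> is raised to \<open>y p\<close>, and the
  slacks \<open>y i - a i\<close>, whose total over \<open>I\<close> is at most the sum of
  \<open>y\<close>, are charged at the largest weight \<open>M\<close> off \<open>p\<close>. The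
  quadratic form left in \<open>y\<close> is the one bounded above, with \<open>u = y p\<close>,
  \<open>v = M\<close> and the other \<open>card I - 2\<close> weights as \<open>R\<close>.\<close>

lemma weighted_loss_bound:
  fixes a y :: "'b \<Rightarrow> real"
  assumes "finite I" "card I \<ge> 2" "p \<in> I"
    and y: "\<And>i. i \<in> I \<Longrightarrow> y i \<ge> 0" and ay: "\<And>i. i \<in> I \<Longrightarrow> a i \<le> y i"
    and "(\<Sum>i\<in>I. a i) \<ge> 0"
  shows "(\<Sum>i\<in>I. y i * (a p - a i)) \<le> sqrt (real (card I) / 2) * (\<Sum>i\<in>I. (y i)\<^sup>2)"
proof -
  let ?J = "I - {p}" and ?\<alpha> = "sqrt (real (card I) / 2)"
  have J: "finite ?J" "?J \<noteq> {}"
    using assms(1,2) card_mono[of "{p}" I] by auto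
  define M where "M = Max (y ` ?J)"
  have "M \<in> y ` ?J" using J unfolding M_def by (intro Max_in) auto
  then obtain m where m: "m \<in> ?J" "y m = M" by auto
  have M: "y i \<le> M" if "i \<in> ?J" for i using J that unfolding M_def by auto
  let ?R = "?J - {m}"
  have cR: "card I = card ?R + 2"
    using assms(1-3) m by (simp add: card_Diff_singleton)
  have split: "(\<Sum>i\<in>I. g i) = g p + g m + (\<Sum>i\<in>?R. g i)" for g :: "'b \<Rightarrow> real"
    using assms(1,3) m by (simp add: sum.remove[of I p] sum.remove[of ?J m])
  have splitJ: "(\<Sum>i\<in>?J. g i) = g m + (\<Sum>i\<in>?R. g i)" for g :: "'b \<Rightarrow> real"
    using J m by (simp add: sum.remove[of ?J m])
  have "M \<ge> 0" using m y by auto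
  have "(\<Sum>i\<in>I. y i * (a p - a i)) = (\<Sum>i\<in>?J. y i * (a p - a i))"
    using assms(1,3) by (simp add: sum.remove[of I p])
  also have "\<dots> \<le> (\<Sum>i\<in>?J. y i * (y p - y i) + M * (y i - a i))"
  proof (rule sum_mono)
    fix i assume i: "i \<in> ?J"
    have "y i * (a p - a i) \<le> y i * (y p - a i)"
      using i assms(3) y ay by (intro mult_left_mono) auto
    moreover have "y i * (y i - a i) \<le> M * (y i - a i)"
      using i M ay by (intro mult_right_mono) auto
    ultimately show "y i * (a p - a i) \<le> y i * (y p - y i) + M * (y i - a i)"
      by (simp add: algebra_simps)
  qed
  also have "\<dots> = (\<Sum>i\<in>?J. y i * (y p - y i)) + M * (\<Sum>i\<in>?J. y i - a i)"
    by (simp add: sum.distrib sum_distrib_left)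
  also have "(\<Sum>i\<in>?J. y i - a i) \<le> (\<Sum>i\<in>I. y i - a i)"
    using assms(1) ay by (intro sum_mono2) auto
  also have "\<dots> \<le> (\<Sum>i\<in>I. y i)"
    using assms(6) by (simp add: sum_subtractf)
  \<comment> \<open>The index \<open>m\<close> contributes \<open>- M\<^sup>2\<close> to the first
    sum and \<open>M\<^sup>2\<close> to the second, so these cancel.\<close>
  also have "(\<Sum>i\<in>?J. y i * (y p - y i)) + M * (\<Sum>i\<in>I. y i)
      = 2 * y p * M + (y p + M) * (\<Sum>i\<in>?R. y i) - (\<Sum>i\<in>?R. (y i)\<^sup>2)"
    unfolding split[of y] splitJ[of "\<lambda>i. y i * (y p - y i)"] m(2)
    by (simp add: algebra_simps sum_subtractf sum.distrib sum_distrib_left power2_eq_square)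
  also have "\<dots> \<le> ?\<alpha> * ((y p)\<^sup>2 + M\<^sup>2) + ?\<alpha> * (\<Sum>i\<in>?R. (y i)\<^sup>2)"
    using loss_quadratic_bound[of ?R ?\<alpha> "y p" M y] J cR by (simp add: algebra_simps)
  also have "\<dots> = ?\<alpha> * (\<Sum>i\<in>I. (y i)\<^sup>2)"
    unfolding split[of "\<lambda>i. (y i)\<^sup>2"] m(2) by (simp add: algebra_simps)
  \<comment> \<open>Two links of the chain rewrote only the factor of \<open>M\<close>;
    \<open>M \<ge> 0\<close> supplies the monotonicity they require.\<close>
  finally show ?thesis using \<open>M \<ge> 0\<close> by (simp add: mult_left_mono)
qed

section \<open>Support and expectation of the random choices\<close>

lemma set_pmf_greedy_choice:
  assumes "k \<ge> 1"
  shows "set_pmf (greedy_choice k f e s) \<subseteq> {1..k}"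
proof (cases "greedy_total k f e s = 0")
  case True
  \<comment> \<open>The fallback label 1 is in range because \<open>k \<ge> 1\<close>.\<close>
  then show ?thesis using assms by (simp add: greedy_choice_def)
next
  case False
  then show ?thesis by (auto simp: set_pmf_iff pmf_greedy_choice split: if_splits)
qed

lemma finite_set_pmf_greedy_from:
  assumes "k \<ge> 1"
  shows "finite (set_pmf (greedy_from k f es s))"
proof (induction es arbitrary: s)
  case (Cons e es)
  have "finite (set_pmf (greedy_choice k f e s))"
    by (rule finite_subset[OF set_pmf_greedy_choice[OF assms]]) simp
  then show ?case using Cons.IH by simp
qed simp

lemma expectation_greedy_from_Cons:
  fixes g :: "('a \<Rightarrow> nat) \<Rightarrow> real"
  assumes "k \<ge> 1"
  shows "measure_pmf.expectation (greedy_from k f (e # es) s) g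
    = (\<Sum>q=1..k. pmf (greedy_choice k f e s) q *
        measure_pmf.expectation (greedy_from k f es (s(e := q))) g)"
  unfolding greedy_from.simps
  by (subst pmf_expectation_bind[OF finite_atLeastAtMost finite_set_pmf_greedy_from[OF assms]
        set_pmf_greedy_choice[OF assms]]) simp

lemma sum_pmf_greedy_choice:
  assumes "k \<ge> 1"
  shows "(\<Sum>q=1..k. pmf (greedy_choice k f e s) q) = 1"
  using set_pmf_greedy_choice[OF assms] by (intro sum_pmf_eq_1) simp_all

section \<open>Loss against gain in a single step\<close>

text \<open>Submodularity in the orthant \<open>h(e := i)\<close>, applied to
  \<open>s(e := i)\<close> and \<open>h(e := 0)\<close>: their \<open>min0\<close> is
  \<open>s\<close> and their \<open>max0\<close> is \<open>h(e := i)\<close>.\<close>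

lemma marginal_antimono:
  assumes sub: "submodular_in_every_orthant U k f"
    and s: "s \<in> partial_solutions U k" and h: "h \<in> orthants U k"
    and sh: "in_orthant U s h"
    and e: "e \<in> U" "s e = 0" and i: "i \<in> {1..k}"
  shows "marginal f i e (h(e := 0)) \<le> marginal f i e s"
proof -
  have out: "s x = undefined" "h x = undefined" if "x \<notin> U" for x
    using s h that by (auto simp: partial_solutions_def orthants_def PiE_iff extensional_def)
  \<comment> \<open>Extended beyond \<open>U\<close>, where both are \<open>undefined\<close>, so
    that the vectors below are equal as functions.\<close>
  have sh': "s x = 0 \<or> s x = h x" for x
    using sh out by (cases "x \<in> U") (auto simp: in_orthant_def)
  have "h(e := i) \<in> orthants U k"
    using h e i by (auto simp: orthants_def PiE_iff extensional_def)
  moreover have "s(e := i) \<in> partial_solutions U k"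
    using s e i by (auto simp: partial_solutions_def PiE_iff extensional_def)
  moreover have "h(e := 0) \<in> partial_solutions U k"
    using h e by (auto simp: partial_solutions_def orthants_def PiE_iff extensional_def)
  moreover have "in_orthant U (s(e := i)) (h(e := i))" "in_orthant U (h(e := 0)) (h(e := i))"
    using sh by (auto simp: in_orthant_def)
  moreover have "(\<lambda>x. min0 ((s(e := i)) x) ((h(e := 0)) x)) = s"
  proof
    fix x show "min0 ((s(e := i)) x) ((h(e := 0)) x) = s x"
      using sh'[of x] e by (auto simp: min0_def)
  qed
  moreover have "(\<lambda>x. max0 ((s(e := i)) x) ((h(e := 0)) x)) = h(e := i)"
  proof
    fix x show "max0 ((s(e := i)) x) ((h(e := 0)) x) = (h(e := i)) x"
      using sh'[of x] e by (auto simp: max0_def)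
  qed
  ultimately have "f (s(e := i)) + f (h(e := 0)) \<ge> f s + f (h(e := i))"
    using sub unfolding submodular_in_every_orthant_def by metis
  then show ?thesis by (simp add: marginal_def)
qed

lemma greedy_step_loss_le_gain:
  assumes k: "k \<ge> 2" and sub: "submodular_in_every_orthant U k f"
    and mono: "k_wise_monotone U k f"
    and s: "s \<in> partial_solutions U k" and h: "h \<in> orthants U k"
    and sh: "in_orthant U s h" and e: "e \<in> U" "s e = 0"
  shows "(\<Sum>q=1..k. pmf (greedy_choice k f e s) q * (f h - f (h(e := q))))
    \<le> sqrt (real k / 2) * (\<Sum>q=1..k. pmf (greedy_choice k f e s) q * marginal f q e s)"
proof -
  let ?a = "\<lambda>i. marginal f i e (h(e := 0))" and ?y = "greedy_weight f e s"
  let ?p = "pmf (greedy_choice k f e s)" and ?\<beta> = "greedy_total k f e s"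
  have loss: "f h - f (h(e := q)) = ?a (h e) - ?a q" for q
    by (simp add: marginal_def)
  have he: "h e \<in> {1..k}" using h e by (auto simp: orthants_def PiE_iff)
  have "h(e := 0) \<in> partial_solutions U k"
    using h e by (auto simp: partial_solutions_def orthants_def PiE_iff extensional_def)
  then have sum_a: "(\<Sum>i=1..k. ?a i) \<ge> 0"
    using mono e unfolding k_wise_monotone_def by auto
  have am: "?a i \<le> marginal f i e s" if "i \<in> {1..k}" for i
    using marginal_antimono[OF sub s h sh e that] .
  have ay: "?a i \<le> ?y i" if "i \<in> {1..k}" for i
    using am[OF that] by (simp add: greedy_weight_def)
  have y: "?y i \<ge> 0" for i by (simp add: greedy_weight_def)
  show ?thesis
  proof (cases "?\<beta> = 0")
    \<comment> \<open>All weights vanish, so the \<open>?a i\<close> are nonpositive with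
      nonnegative sum, hence zero. The loss is then zero, and the marginals at \<open>s\<close>
      dominate these zeros.\<close>
    case True
    then have "?y i = 0" if "i \<in> {1..k}" for i
      using that y by (simp add: greedy_total_def sum_nonneg_eq_0_iff)
    then have a_nonpos: "?a i \<le> 0" if "i \<in> {1..k}" for i using ay that by fastforce
    then have "(\<Sum>i=1..k. - ?a i) = 0"
      using sum_a sum_nonpos[of "{1..k}" ?a] by (simp add: sum_negf)
    then have a0: "?a i = 0" if "i \<in> {1..k}" for i
      using sum_nonneg_eq_0_iff[of "{1..k}" "\<lambda>i. - ?a i"] a_nonpos that by auto
    have "(\<Sum>q=1..k. ?p q * (f h - f (h(e := q)))) = 0"
      unfolding loss using a0 he by (intro sum.neutral) simp
    also have "0 \<le> sqrt (real k / 2) * (\<Sum>q=1..k. ?p q * marginal f q e s)"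
    proof (intro mult_nonneg_nonneg sum_nonneg)
      fix q assume "q \<in> {1..k}"
      then show "0 \<le> marginal f q e s" using am[of q] a0[of q] by simp
    qed simp_all
    finally show ?thesis .
  next
    case False
    then have \<beta>: "?\<beta> > 0" using y by (simp add: greedy_total_def sum_nonneg less_le)
    have p: "?p q = ?y q / ?\<beta>" if "q \<in> {1..k}" for q
      using pmf_greedy_choice[OF False] that by simp
    have "(\<Sum>q=1..k. ?p q * (f h - f (h(e := q)))) = (\<Sum>q=1..k. ?y q * (?a (h e) - ?a q)) / ?\<beta>"
      unfolding loss sum_divide_distrib using p by (intro sum.cong) simp_all
    also have "\<dots> \<le> sqrt (real k / 2) * (\<Sum>q=1..k. (?y q)\<^sup>2) / ?\<beta>"
      using weighted_loss_bound[of "{1..k}" "h e" ?y ?a] k he y ay sum_a \<beta>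
      by (intro divide_right_mono) auto
    \<comment> \<open>A label with negative marginal has weight zero, so weight times marginal is
      always the squared weight.\<close>
    also have "(\<Sum>q=1..k. (?y q)\<^sup>2) = ?\<beta> * (\<Sum>q=1..k. ?p q * marginal f q e s)"
      unfolding sum_distrib_left using p False
      by (intro sum.cong) (auto simp: greedy_weight_def power2_eq_square max_def)
    also have "sqrt (real k / 2) * (?\<beta> * (\<Sum>q=1..k. ?p q * marginal f q e s)) / ?\<beta>
        = sqrt (real k / 2) * (\<Sum>q=1..k. ?p q * marginal f q e s)"
      using False by simp
    finally show ?thesis .
  qed
qed

text \<open>Telescopes the one-step bound over the remaining elements. The hybrid \<open>h\<close>
  is an arbitrary orthant extending \<open>s\<close>, since \<open>h(e := q)\<close> need not be
  optimal when the induction hypothesis is applied to it.\<close>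

lemma greedy_from_loss_le_gain:
  assumes k: "k \<ge> 2" and sub: "submodular_in_every_orthant U k f"
    and mono: "k_wise_monotone U k f"
    and "distinct es" "set es \<subseteq> U"
    and "s \<in> partial_solutions U k" "h \<in> orthants U k"
    and "\<And>e. e \<in> set es \<Longrightarrow> s e = 0" "\<And>e. e \<notin> set es \<Longrightarrow> s e = h e"
  shows "f h - measure_pmf.expectation (greedy_from k f es s) f
    \<le> sqrt (real k / 2) * (measure_pmf.expectation (greedy_from k f es s) f - f s)"
  using assms(4-)
proof (induction es arbitrary: s h)
  case Nil
  then have "s = h" by auto
  then show ?case by simp
next
  case (Cons e es)
  let ?p = "pmf (greedy_choice k f e s)" and ?\<alpha> = "sqrt (real k / 2)"
  let ?E = "\<lambda>q. measure_pmf.expectation (greedy_from k f es (s(e := q))) f"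
  let ?F = "measure_pmf.expectation (greedy_from k f (e # es) s) f"
  have k1: "k \<ge> 1" using k by simp
  have F: "?F = (\<Sum>q=1..k. ?p q * ?E q)"
    by (rule expectation_greedy_from_Cons[OF k1])
  \<comment> \<open>Used with \<open>c = f h\<close> and \<open>c = f s\<close> to combine the first
    step with the rest of the run.\<close>
  have mean: "(\<Sum>q=1..k. ?p q * (g q - c)) = (\<Sum>q=1..k. ?p q * g q) - c" for g c
    using sum_pmf_greedy_choice[OF k1, of f e s]
    by (simp add: right_diff_distrib sum_subtractf flip: sum_distrib_right)
  have IH: "f (h(e := q)) - ?E q \<le> ?\<alpha> * (?E q - f (s(e := q)))" if "q \<in> {1..k}" for q
  proof (rule Cons.IH)
    show "s(e := q) \<in> partial_solutions U k" "h(e := q) \<in> orthants U k"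
      using Cons.prems that
      by (auto simp: partial_solutions_def orthants_def PiE_iff extensional_def)
  qed (use Cons.prems in auto)
  have "(\<Sum>q=1..k. ?p q * (f (h(e := q)) - ?E q)) \<le> (\<Sum>q=1..k. ?p q * (?\<alpha> * (?E q - f (s(e := q)))))"
    by (intro sum_mono mult_left_mono IH) auto
  moreover have "(\<Sum>q=1..k. ?p q * (f h - f (h(e := q)))) \<le> ?\<alpha> * (\<Sum>q=1..k. ?p q * marginal f q e s)"
  proof (rule greedy_step_loss_le_gain[OF k sub mono])
    show "in_orthant U s h" unfolding in_orthant_def using Cons.prems by blast
  qed (use Cons.prems in auto)
  ultimately have
    "(\<Sum>q=1..k. ?p q * (f (h(e := q)) - ?E q)) + (\<Sum>q=1..k. ?p q * (f h - f (h(e := q))))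
      \<le> (\<Sum>q=1..k. ?p q * (?\<alpha> * (?E q - f (s(e := q))))) + ?\<alpha> * (\<Sum>q=1..k. ?p q * marginal f q e s)"
    by (rule add_mono)
  moreover have "(\<Sum>q=1..k. ?p q * (f (h(e := q)) - ?E q)) + (\<Sum>q=1..k. ?p q * (f h - f (h(e := q))))
      = f h - ?F"
  proof -
    have "f h - ?F = - (\<Sum>q=1..k. ?p q * (?E q - f h))" unfolding mean F by simp
    also have "\<dots> = (\<Sum>q=1..k. ?p q * (f (h(e := q)) - ?E q)) + (\<Sum>q=1..k. ?p q * (f h - f (h(e := q))))"
      by (simp add: sum_negf[symmetric] sum.distrib[symmetric] algebra_simps)
    finally show ?thesis by simp
  qed
  moreover have "(\<Sum>q=1..k. ?p q * (?\<alpha> * (?E q - f (s(e := q))))) + ?\<alpha> * (\<Sum>q=1..k. ?p q * marginal f q e s)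
      = ?\<alpha> * (?F - f s)"
  proof -
    have "?\<alpha> * (?F - f s) = ?\<alpha> * (\<Sum>q=1..k. ?p q * (?E q - f s))" unfolding mean F by simp
    also have "\<dots> = (\<Sum>q=1..k. ?p q * (?\<alpha> * (?E q - f (s(e := q))))) + ?\<alpha> * (\<Sum>q=1..k. ?p q * marginal f q e s)"
      unfolding sum_distrib_left sum.distrib[symmetric] marginal_def
      by (intro sum.cong) (simp_all add: algebra_simps)
    finally show ?thesis by simp
  qed
  ultimately show ?case by simp
qed

theorem theorem19:
  fixes U :: "'a set" and k :: nat
    and f :: "('a \<Rightarrow> nat) \<Rightarrow> real"
    and opt :: "'a \<Rightarrow> nat" and es :: "'a list"
  assumes "k \<ge> 2"
    and "finite U" and "U \<noteq> {}"
    and "\<And>s. s \<in> partial_solutions U k \<Longrightarrow> f s \<ge> 0"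
    and "submodular_in_every_orthant U k f"
    and "k_wise_monotone U k f"
    and "is_arg_max f (\<lambda>x. x \<in> orthants U k) opt"
    and "distinct es" and "set es = U"
  shows "(1 + sqrt (real k / 2)) * measure_pmf.expectation (randomized_greedy U k f es) f \<ge> f opt"
proof -
  let ?z = "\<lambda>e\<in>U. 0::nat" and ?E = "measure_pmf.expectation (randomized_greedy U k f es) f"
  have opt: "opt \<in> orthants U k" using assms(7) by (simp add: is_arg_max_def)
  have z: "?z \<in> partial_solutions U k" by (auto simp: partial_solutions_def)
  have "f opt - ?E \<le> sqrt (real k / 2) * (?E - f ?z)"
    unfolding randomized_greedy_def
  proof (rule greedy_from_loss_le_gain[OF assms(1,5,6,8) _ z opt])
    \<comment> \<open>Such \<open>e\<close> lie outside \<open>U\<close>, where both vectors are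
      \<open>undefined\<close>.\<close>
    show "?z e = opt e" if "e \<notin> set es" for e
      using that assms(9) opt by (auto simp: orthants_def PiE_iff extensional_def)
  qed (use assms(9) in auto)
  \<comment> \<open>Nonnegativity of \<open>f\<close> at the empty solution lets the starting value
    be dropped from the gain.\<close>
  moreover have "sqrt (real k / 2) * f ?z \<ge> 0" using assms(4)[OF z] by simp
  ultimately show ?thesis by (simp add: algebra_simps)
qed

end
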